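(* Let $\mathcal{G}=(B,\psi,A)$ be a finite quantum graph such that $\psi$ is a $\delta$-form and $A$ is completely positive, and suppose that its quantum edge correspondence $E_{\mathcal{G}}$ is full. Then $E_{\mathcal{G}}$ is minimal if and only if there is no non-trivial ideal $J\triangleleft B$ such that $A(J)\subseteq J$.
   Context: Quantum graphs: $B$ is a finite-dimensional C*-algebra, $\psi$ a state on $B$, $L^2(B,\psi)$ is $B$ with inner product $\psi(x^*y)$, $m:L^2(B\otimes B,\psi\otimes\psi)\to L^2(B,\psi)$ is $m(x\otimes y)=xy$, and $m^*$ is its Hilbert space adjoint. For $\delta>0$, $\psi$ is a $\delta$-form if $mm^*=\delta^2\,\mathrm{id}_B$. A linear map $A:B\to B$ is quantum Schur idempotent if $m(A\otimes A)m^*=\delta^2A$. A finite quantum graph is a triple $\mathcal{G}=(B,\psi,A)$ with $A$ quantum Schur idempotent (here also completely positive). Quantum edge correspondence: $B\otimes_\psi B$ is $B\otimes B$ with actions $a\cdot(x\otimes y)\cdot b=ax\otimes yb$ and inner product $\langle x\otimes y\,|\,z\otimes w\rangle=y^*\psi(x^*z)w$. Put $\varepsilon_{\mathcal{G}}:=\delta^{-2}(\mathrm{id}_B\otimes A)m^*(1_B)$ and $E_{\mathcal{G}}:=\mathrm{Span}\{x\cdot\varepsilon_{\mathcal{G}}\cdot y:x,y\in B\}\subseteq B\otimes_\psi B$; its inner product satisfies $\langle x_1\cdot\varepsilon_{\mathcal{G}}\cdot y_1\,|\,x_2\cdot\varepsilon_{\mathcal{G}}\cdot y_2\rangle=\delta^{-2}y_1^*A(x_1^*x_2)y_2$.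 A C*-correspondence $X$ over $B$ is full if $\overline{\mathrm{span}}\,\langle X\,|\,X\rangle=B$. It is minimal if there are no nontrivial ideals $J\triangleleft B$ (i.e. other than $0$ and $B$; ideals are closed and two-sided) such that $\langle X\,|\,JX\rangle\subseteq J$, where $\langle X\,|\,JX\rangle=\mathrm{Span}\{\langle x\,|\,b\cdot y\rangle:x,y\in X,\ b\in J\}$. *)

theory Defs
  imports "HOL-Analysis.Analysis" "HOL-Library.Poly_Mapping"
begin

section \<open>Complex vector spaces and finite-dimensional C*-algebras\<close>

class complex_vector = ab_group_add +
  fixes scaleC :: "complex \<Rightarrow> 'a \<Rightarrow> 'a"  (infixr "*\<^sub>C" 75)
  assumes scaleC_add_right: "c *\<^sub>C (x + y) = c *\<^sub>C x + c *\<^sub>C y"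
    and scaleC_add_left: "(c + d) *\<^sub>C x = c *\<^sub>C x + d *\<^sub>C x"
    and scaleC_scaleC: "c *\<^sub>C (d *\<^sub>C x) = (c * d) *\<^sub>C x"
    and scaleC_one: "1 *\<^sub>C x = x"

global_interpretation complex_vector:
  vector_space "scaleC :: complex \<Rightarrow> 'a::complex_vector \<Rightarrow> 'a"
  defines csubspace = complex_vector.subspace
    and cspan = complex_vector.span
  by unfold_locales (auto simp: scaleC_add_right scaleC_add_left scaleC_scaleC scaleC_one)

instantiation complex :: complex_vector
begin
definition scaleC_complex :: "complex \<Rightarrow> complex \<Rightarrow> complex"
  where "scaleC_complex c z = c * z"
instance
  by standard (auto simp: scaleC_complex_def algebra_simps)
end

abbreviation clinear :: "('a::complex_vector \<Rightarrow> 'b::complex_vector) \<Rightarrow> bool"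
  where "clinear \<equiv> Vector_Spaces.linear scaleC scaleC"

definition antilinear :: "('a::complex_vector \<Rightarrow> 'b::complex_vector) \<Rightarrow> bool"
  where "antilinear f \<longleftrightarrow>
    (\<forall>x y. f (x + y) = f x + f y) \<and> (\<forall>c x. f (c *\<^sub>C x) = cnj c *\<^sub>C f x)"

text \<open>Unital C*-algebras. The class \<open>real_normed_algebra_1\<close> requires \<open>0 \<noteq> 1\<close>, which is no
  restriction for an algebra that carries a state. Every finite-dimensional C*-algebra is unital.\<close>

class cstar_algebra = real_normed_algebra_1 + banach + complex_vector +
  fixes star :: "'a \<Rightarrow> 'a"
  assumes scaleR_scaleC: "scaleR r x = complex_of_real r *\<^sub>C x"
    and norm_scaleC: "norm (c *\<^sub>C x) = cmod c * norm x"
    and mult_scaleC_left: "(c *\<^sub>C x) * y = c *\<^sub>C (x * y)"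
    and mult_scaleC_right: "x * (c *\<^sub>C y) = c *\<^sub>C (x * y)"
    and star_add: "star (x + y) = star x + star y"
    and star_scaleC: "star (c *\<^sub>C x) = cnj c *\<^sub>C star x"
    and star_mult: "star (x * y) = star y * star x"
    and star_star: "star (star x) = x"
    and cstar_identity: "norm (star x * x) = norm x * norm x"

class fd_cstar_algebra = cstar_algebra +
  assumes finite_dimensional: "\<exists>S. finite S \<and> (\<forall>x. \<exists>c. x = (\<Sum>s\<in>S. c s *\<^sub>C s))"

instantiation complex :: fd_cstar_algebra
begin
definition star_complex :: "complex \<Rightarrow> complex"
  where "star_complex = cnj"
instance
proof
  show "\<exists>S. finite S \<and> (\<forall>x :: complex. \<exists>c. x = (\<Sum>s\<in>S. c s *\<^sub>C s))"
    by (rule exI[of _ "{1}"]) (auto simp: scaleC_complex_def)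
qed (auto simp: star_complex_def scaleC_complex_def norm_mult scaleR_conv_of_real)
end


section \<open>The algebraic tensor product\<close>

text \<open>The tensor product is the quotient of the free complex vector space on pairs by the subspace
  generated by the bilinearity relations.\<close>

inductive_set tensor_null :: "(('a::complex_vector \<times> 'b::complex_vector) \<Rightarrow>\<^sub>0 complex) set"
  where
    zero: "0 \<in> tensor_null"
  | add: "p \<in> tensor_null \<Longrightarrow> q \<in> tensor_null \<Longrightarrow> p + q \<in> tensor_null"
  | scale: "p \<in> tensor_null \<Longrightarrow> Poly_Mapping.map ((*) c) p \<in> tensor_null"
  | add_left: "Poly_Mapping.single (x + x', y) 1
      - Poly_Mapping.single (x, y) 1 - Poly_Mapping.single (x', y) 1 \<in> tensor_null"
  | add_right: "Poly_Mapping.single (x, y + y') 1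
      - Poly_Mapping.single (x, y) 1 - Poly_Mapping.single (x, y') 1 \<in> tensor_null"
  | scale_left: "Poly_Mapping.single (c *\<^sub>C x, y) 1 - Poly_Mapping.single (x, y) c \<in> tensor_null"
  | scale_right: "Poly_Mapping.single (x, c *\<^sub>C y) 1 - Poly_Mapping.single (x, y) c \<in> tensor_null"

lemma lookup_map_times:
  "Poly_Mapping.lookup (Poly_Mapping.map ((*) c) p) k = c * Poly_Mapping.lookup p k" for c :: complex
  by (simp add: Poly_Mapping.map.rep_eq when_def)

lemma tensor_null_uminus: "p \<in> tensor_null \<Longrightarrow> - p \<in> tensor_null"
proof -
  assume "p \<in> tensor_null"
  moreover have "- p = Poly_Mapping.map ((*) (-1)) p"
    by (rule poly_mapping_eqI) (simp add: lookup_map_times)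
  ultimately show ?thesis by (simp add: tensor_null.scale)
qed

lemma tensor_null_diff: "p \<in> tensor_null \<Longrightarrow> q \<in> tensor_null \<Longrightarrow> p - q \<in> tensor_null"
  using tensor_null.add[of p "- q"] tensor_null_uminus[of q] by simp

quotient_type (overloaded) ('a, 'b) tensor =
  "('a::complex_vector \<times> 'b::complex_vector) \<Rightarrow>\<^sub>0 complex" /
  "\<lambda>p q. p - q \<in> tensor_null"
proof (rule equivpI)
  show "reflp (\<lambda>p q :: ('a \<times> 'b) \<Rightarrow>\<^sub>0 complex. p - q \<in> tensor_null)"
    by (simp add: reflp_def tensor_null.zero)
  show "symp (\<lambda>p q :: ('a \<times> 'b) \<Rightarrow>\<^sub>0 complex. p - q \<in> tensor_null)"
    unfolding symp_def using tensor_null_uminus by fastforce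
  show "transp (\<lambda>p q :: ('a \<times> 'b) \<Rightarrow>\<^sub>0 complex. p - q \<in> tensor_null)"
    unfolding transp_def
  proof (intro allI impI)
    fix p q r :: "('a \<times> 'b) \<Rightarrow>\<^sub>0 complex"
    assume "p - q \<in> tensor_null" "q - r \<in> tensor_null"
    from tensor_null.add[OF this] show "p - r \<in> tensor_null" by simp
  qed
qed

instantiation tensor :: (complex_vector, complex_vector) complex_vector
begin

lift_definition zero_tensor :: "('a, 'b) tensor" is 0 .

lift_definition plus_tensor :: "('a, 'b) tensor \<Rightarrow> ('a, 'b) tensor \<Rightarrow> ('a, 'b) tensor" is "(+)"
  using tensor_null.add by (metis add_diff_add)

lift_definition uminus_tensor :: "('a, 'b) tensor \<Rightarrow> ('a, 'b) tensor" is uminus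
  using tensor_null_uminus by fastforce

lift_definition minus_tensor :: "('a, 'b) tensor \<Rightarrow> ('a, 'b) tensor \<Rightarrow> ('a, 'b) tensor" is "(-)"
proof -
  fix p p' q q' :: "('a \<times> 'b) \<Rightarrow>\<^sub>0 complex"
  assume "p - p' \<in> tensor_null" "q - q' \<in> tensor_null"
  from tensor_null_diff[OF this] show "p - q - (p' - q') \<in> tensor_null"
    by (simp add: algebra_simps)
qed

lift_definition scaleC_tensor :: "complex \<Rightarrow> ('a, 'b) tensor \<Rightarrow> ('a, 'b) tensor"
  is "\<lambda>c. Poly_Mapping.map ((*) c)"
proof -
  fix c and p q :: "('a \<times> 'b) \<Rightarrow>\<^sub>0 complex"
  assume "p - q \<in> tensor_null"
  moreover have "Poly_Mapping.map ((*) c) p - Poly_Mapping.map ((*) c) q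
      = Poly_Mapping.map ((*) c) (p - q)"
    by (rule poly_mapping_eqI) (simp add: lookup_map_times lookup_minus algebra_simps)
  ultimately show "Poly_Mapping.map ((*) c) p - Poly_Mapping.map ((*) c) q \<in> tensor_null"
    by (simp add: tensor_null.scale)
qed

lemma tensor_null_eqI: "p = q \<Longrightarrow> p - q \<in> tensor_null"
  by (simp add: tensor_null.zero)

instance
  by standard
    (transfer; rule tensor_null_eqI; rule poly_mapping_eqI;
      simp add: lookup_map_times lookup_add lookup_minus algebra_simps)+

end

lift_definition tens :: "'a::complex_vector \<Rightarrow> 'b::complex_vector \<Rightarrow> ('a, 'b) tensor"
    (infixr "\<otimes>\<^sub>t" 72)
  is "\<lambda>x y. Poly_Mapping.single (x, y) 1" .

definition bilin :: "('a::complex_vector \<Rightarrow> 'b::complex_vector \<Rightarrow> 'c::complex_vector) \<Rightarrow> bool"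
  where "bilin \<beta> \<longleftrightarrow> (\<forall>x. clinear (\<beta> x)) \<and> (\<forall>y. clinear (\<lambda>x. \<beta> x y))"

definition tensor_lift ::
    "('a::complex_vector \<Rightarrow> 'b::complex_vector \<Rightarrow> 'c::complex_vector) \<Rightarrow> ('a, 'b) tensor \<Rightarrow> 'c"
  where "tensor_lift \<beta> = (THE f. clinear f \<and> (\<forall>x y. f (x \<otimes>\<^sub>t y) = \<beta> x y))"

definition tensor_map :: "('a::complex_vector \<Rightarrow> 'c::complex_vector) \<Rightarrow>
    ('b::complex_vector \<Rightarrow> 'd::complex_vector) \<Rightarrow> ('a, 'b) tensor \<Rightarrow> ('c, 'd) tensor"
  where "tensor_map f g = tensor_lift (\<lambda>x y. f x \<otimes>\<^sub>t g y)"

text \<open>The sesquilinear map \<open>F\<close> (antilinear in the first argument) with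
  \<open>F (x \<otimes> y) (z \<otimes> w) = \<beta> x y z w\<close>.\<close>

definition tensor_sesq :: "('a::complex_vector \<Rightarrow> 'b::complex_vector \<Rightarrow> 'a \<Rightarrow> 'b \<Rightarrow> 'c::complex_vector)
    \<Rightarrow> ('a, 'b) tensor \<Rightarrow> ('a, 'b) tensor \<Rightarrow> 'c"
  where "tensor_sesq \<beta> = (THE F. (\<forall>s. clinear (F s)) \<and> (\<forall>t. antilinear (\<lambda>s. F s t)) \<and>
    (\<forall>x y z w. F (x \<otimes>\<^sub>t y) (z \<otimes>\<^sub>t w) = \<beta> x y z w))"

subsection \<open>Well-definedness of the extensions\<close>

lemma clinear_iff:
  "clinear f \<longleftrightarrow> (\<forall>x y. f (x + y) = f x + f y) \<and> (\<forall>c x. f (c *\<^sub>C x) = c *\<^sub>C f x)"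
  by (simp add: Vector_Spaces.linear_iff complex_vector.vector_space_axioms)

lemma tens_add_left: "(x + x') \<otimes>\<^sub>t y = x \<otimes>\<^sub>t y + x' \<otimes>\<^sub>t y"
  by transfer (use tensor_null.add_left in \<open>simp add: diff_diff_eq\<close>)

lemma tens_add_right: "x \<otimes>\<^sub>t (y + y') = x \<otimes>\<^sub>t y + x \<otimes>\<^sub>t y'"
  by transfer (use tensor_null.add_right in \<open>simp add: diff_diff_eq\<close>)

lemma map_times_single:
  "Poly_Mapping.map ((*) c) (Poly_Mapping.single k d) = Poly_Mapping.single k (c * d)" for c :: complex
  by (rule poly_mapping_eqI) (simp add: lookup_map_times lookup_single when_def)

lemma tens_scale_left: "(c *\<^sub>C x) \<otimes>\<^sub>t y = c *\<^sub>C (x \<otimes>\<^sub>t y)"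
  by transfer (use tensor_null.scale_left in \<open>simp add: map_times_single\<close>)

lemma tens_scale_right: "x \<otimes>\<^sub>t (c *\<^sub>C y) = c *\<^sub>C (x \<otimes>\<^sub>t y)"
  by transfer (use tensor_null.scale_right in \<open>simp add: map_times_single\<close>)

lemma poly_mapping_induct_add [case_names zero add single]:
  fixes p :: "'k \<Rightarrow>\<^sub>0 complex"
  assumes "P 0" "\<And>p q. P p \<Longrightarrow> P q \<Longrightarrow> P (p + q)" "\<And>k c. P (Poly_Mapping.single k c)"
  shows "P p"
proof -
  have "P (\<Sum>k\<in>A. Poly_Mapping.single k (Poly_Mapping.lookup p k))" if "finite A" for A
    using that by (induction A) (auto intro: assms)
  then have "P (\<Sum>k\<in>Poly_Mapping.keys p. Poly_Mapping.single k (Poly_Mapping.lookup p k))"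
    by simp
  moreover have
    "(\<Sum>k\<in>Poly_Mapping.keys p. Poly_Mapping.single k (Poly_Mapping.lookup p k)) = p"
    by (rule poly_mapping_eqI)
      (simp add: lookup_sum lookup_single when_def in_keys_iff sum.delta)
  ultimately show ?thesis by simp
qed

lemma tensor_exhaust:
  obtains p where "t = abs_tensor p"
  by (metis Quotient_abs_rep[OF Quotient_tensor])

lemma tensor_induct [case_names zero add scale]:
  assumes "P 0" "\<And>s t. P s \<Longrightarrow> P t \<Longrightarrow> P (s + t)" "\<And>c x y. P (c *\<^sub>C (x \<otimes>\<^sub>t y))"
  shows "P t"
proof -
  have "P (abs_tensor p)" for p
  proof (induction p rule: poly_mapping_induct_add)
    case zero
    then show ?case using assms(1) by (simp add: zero_tensor_def)
  next
    case (add p q)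
    then show ?case using assms(2) by (metis plus_tensor.abs_eq)
  next
    case (single k c)
    obtain x y where k: "k = (x, y)" by (cases k)
    have "abs_tensor (Poly_Mapping.single k c) = c *\<^sub>C (x \<otimes>\<^sub>t y)"
      by (simp add: k tens.abs_eq scaleC_tensor.abs_eq map_times_single)
    then show ?case using assms(3) by simp
  qed
  then show ?thesis by (metis tensor_exhaust)
qed

text \<open>The lemma is stated for \<open>\<sigma> = id\<close> and \<open>\<sigma> = cnj\<close> at once.\<close>

lemma tensor_lift_exists_gen:
  fixes \<beta> :: "'a::complex_vector \<Rightarrow> 'b::complex_vector \<Rightarrow> 'c::complex_vector"
  assumes \<sigma>: "\<And>c d. \<sigma> (c + d) = \<sigma> c + \<sigma> d" "\<And>c d. \<sigma> (c * d) = \<sigma> c * \<sigma> d" "\<sigma> 1 = 1"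
    and \<beta>: "\<And>x x' y. \<beta> (x + x') y = \<beta> x y + \<beta> x' y" "\<And>x y y'. \<beta> x (y + y') = \<beta> x y + \<beta> x y'"
      "\<And>c x y. \<beta> (c *\<^sub>C x) y = \<sigma> c *\<^sub>C \<beta> x y" "\<And>c x y. \<beta> x (c *\<^sub>C y) = \<sigma> c *\<^sub>C \<beta> x y"
  obtains f where "\<And>s t. f (s + t) = f s + f t" "\<And>c s. f (c *\<^sub>C s) = \<sigma> c *\<^sub>C f s"
    "\<And>x y. f (x \<otimes>\<^sub>t y) = \<beta> x y"
proof -
  have \<sigma>0: "\<sigma> 0 = 0" using \<sigma>(1)[of 0 0] by simp
  define g where "g p = (\<Sum>k\<in>Poly_Mapping.keys p.
    \<sigma> (Poly_Mapping.lookup p k) *\<^sub>C \<beta> (fst k) (snd k))" for p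
  have g_on: "g p = (\<Sum>k\<in>S. \<sigma> (Poly_Mapping.lookup p k) *\<^sub>C \<beta> (fst k) (snd k))"
    if "finite S" "Poly_Mapping.keys p \<subseteq> S" for p S
    unfolding g_def by (rule sum.mono_neutral_left) (use that \<sigma>0 in \<open>auto simp: in_keys_iff\<close>)
  have g_add: "g (p + q) = g p + g q" for p q
    using keys_add[of p q]
    by (subst (1 2 3) g_on[of "Poly_Mapping.keys p \<union> Poly_Mapping.keys q"])
      (auto simp: lookup_add \<sigma> scaleC_add_left sum.distrib)
  have g_scale: "g (Poly_Mapping.map ((*) c) p) = \<sigma> c *\<^sub>C g p" for c p
    by (subst (1 2) g_on[of "Poly_Mapping.keys p"])
      (auto simp: lookup_map_times \<sigma> complex_vector.scale_sum_right scaleC_scaleC in_keys_iff)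
  have g_uminus: "g (- p) = - g p" for p
    using g_add[of p "- p"] by (simp add: g_def eq_neg_iff_add_eq_0 add.commute)
  have g_diff: "g (p - q) = g p - g q" for p q
    using g_add[of p "- q"] g_uminus[of q] by simp
  have g_single: "g (Poly_Mapping.single (x, y) c) = \<sigma> c *\<^sub>C \<beta> x y" for x y c
    by (subst g_on[of "{(x, y)}"]) (auto split: if_splits)
  have g_null: "g p = 0" if "p \<in> tensor_null" for p
    using that
    by induction (auto simp: g_add g_scale g_diff g_single \<beta> \<sigma> scaleC_one, simp add: g_def)
  define f where "f t = g (rep_tensor t)" for t
  have f_abs: "f (abs_tensor p) = g p" for p
  proof -
    have "rep_tensor (abs_tensor p) - p \<in> tensor_null"
      by (rule Quotient_rep_abs[OF Quotient_tensor, of p]) (simp add: tensor_null.zero)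
    from g_null[OF this] show ?thesis by (simp add: g_diff f_def)
  qed
  show ?thesis
  proof
    show "f (s + t) = f s + f t" for s t
      by (rule tensor_exhaust[of s], rule tensor_exhaust[of t]) (simp add: f_abs g_add plus_tensor.abs_eq)
    show "f (c *\<^sub>C s) = \<sigma> c *\<^sub>C f s" for c s
      by (rule tensor_exhaust[of s]) (simp add: f_abs g_scale scaleC_tensor.abs_eq)
    show "f (x \<otimes>\<^sub>t y) = \<beta> x y" for x y
      by (simp add: tens.abs_eq f_abs g_single \<sigma> scaleC_one)
  qed
qed

lemma clinear_tensor_eqI:
  assumes "clinear f" "clinear g" "\<And>x y. f (x \<otimes>\<^sub>t y) = g (x \<otimes>\<^sub>t y)"
  shows "f = g"
proof
  fix t
  have "f 0 = 0" "g 0 = 0"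
    using assms(1,2) unfolding clinear_iff by (metis add_cancel_right_left)+
  then show "f t = g t"
    by (induction t rule: tensor_induct) (use assms in \<open>auto simp: clinear_iff\<close>)
qed

lemma tensor_lift:
  assumes "bilin \<beta>"
  shows "clinear (tensor_lift \<beta>)" "tensor_lift \<beta> (x \<otimes>\<^sub>t y) = \<beta> x y"
proof -
  obtain f where "clinear f \<and> (\<forall>x y. f (x \<otimes>\<^sub>t y) = \<beta> x y)"
    using assms tensor_lift_exists_gen[of "\<lambda>c. c" \<beta>] unfolding bilin_def clinear_iff by metis
  then have "\<exists>!f. clinear f \<and> (\<forall>x y. f (x \<otimes>\<^sub>t y) = \<beta> x y)"
    by (metis clinear_tensor_eqI)
  from theI'[OF this] show "clinear (tensor_lift \<beta>)" "tensor_lift \<beta> (x \<otimes>\<^sub>t y) = \<beta> x y"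
    unfolding tensor_lift_def by auto
qed

lemma tensor_sesq:
  assumes "\<And>x y. bilin (\<beta> x y)"
    and "\<And>y z w. antilinear (\<lambda>x. \<beta> x y z w)" "\<And>x z w. antilinear (\<lambda>y. \<beta> x y z w)"
  shows "clinear (tensor_sesq \<beta> s)" "antilinear (\<lambda>s. tensor_sesq \<beta> s t)"
    "tensor_sesq \<beta> (x \<otimes>\<^sub>t y) (z \<otimes>\<^sub>t w) = \<beta> x y z w"
proof -
  define P where "P F \<longleftrightarrow> (\<forall>s. clinear (F s)) \<and> (\<forall>t. antilinear (\<lambda>s. F s t)) \<and>
    (\<forall>x y z w. F (x \<otimes>\<^sub>t y) (z \<otimes>\<^sub>t w) = \<beta> x y z w)" for F
  define L where "L x y = tensor_lift (\<beta> x y)" for x y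
  have L: "clinear (L x y)" "L x y (z \<otimes>\<^sub>t w) = \<beta> x y z w" for x y z w
    unfolding L_def using assms(1) by (auto intro: tensor_lift)
  have lin_sum: "clinear (\<lambda>t. f t + g t)" if "clinear f" "clinear g"
    for f g :: "('a, 'b) tensor \<Rightarrow> 'c"
    using that by (simp add: clinear_iff scaleC_add_right)
  have lin_scale: "clinear (\<lambda>t. c *\<^sub>C f t)" if "clinear f"
    for f :: "('a, 'b) tensor \<Rightarrow> 'c" and c
    using that by (simp add: clinear_iff scaleC_add_right scaleC_scaleC mult.commute)
  have anti: "L (x + x') y = (\<lambda>t. L x y t + L x' y t)" "L x (y + y') = (\<lambda>t. L x y t + L x y' t)"
    "L (c *\<^sub>C x) y = (\<lambda>t. cnj c *\<^sub>C L x y t)" "L x (c *\<^sub>C y) = (\<lambda>t. cnj c *\<^sub>C L x y t)" for x x' y y' c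
    by (rule clinear_tensor_eqI; use assms(2,3) in
        \<open>auto simp: L antilinear_def intro!: L lin_sum lin_scale\<close>)+
  have "\<exists>f. (\<forall>s s'. f (s + s') = f s + f s') \<and> (\<forall>c s. f (c *\<^sub>C s) = cnj c *\<^sub>C f s) \<and>
      (\<forall>x y. f (x \<otimes>\<^sub>t y) = L x y t)" for t
    using tensor_lift_exists_gen[of cnj "\<lambda>x y. L x y t"] by (simp add: anti) metis
  then obtain G where G: "\<And>t s s'. G t (s + s') = G t s + G t s'"
      "\<And>t c s. G t (c *\<^sub>C s) = cnj c *\<^sub>C G t s" "\<And>t x y. G t (x \<otimes>\<^sub>t y) = L x y t"
    by metis
  have G0: "G t 0 = 0" for t using G(1)[of t 0 0] by simp
  have "clinear (\<lambda>t. G t s)" for s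
  proof (induction s rule: tensor_induct)
    case zero
    then show ?case by (simp add: clinear_iff G0)
  next
    case (add s s')
    then show ?case by (simp add: G lin_sum)
  next
    case (scale c x y)
    have "clinear (\<lambda>t. cnj c *\<^sub>C L x y t)" by (intro lin_scale L)
    then show ?case by (simp add: G)
  qed
  then have ex: "P (\<lambda>s t. G t s)" by (auto simp: P_def G L antilinear_def)
  have "F = F'" if "P F" "P F'" for F F'
  proof -
    note F = that(1)[unfolded P_def] and F' = that(2)[unfolded P_def]
    have "F s t = F' s t" for s t
    proof (induction s rule: tensor_induct)
      case zero
      have "F 0 t = 0" "F' 0 t = 0"
        using F F' unfolding antilinear_def by (metis add_cancel_right_left)+
      then show ?case by simp
    next
      case (add s s')
      then show ?case using F F' by (simp add: antilinear_def)
    next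
      case (scale c x y)
      have "F (x \<otimes>\<^sub>t y) = F' (x \<otimes>\<^sub>t y)" by (rule clinear_tensor_eqI) (use F F' in auto)
      then show ?case using F F' by (simp add: antilinear_def)
    qed
    then show ?thesis by (intro ext)
  qed
  then have "\<exists>!F. P F" using ex by blast
  from theI'[OF this] show "clinear (tensor_sesq \<beta> s)" "antilinear (\<lambda>s. tensor_sesq \<beta> s t)"
    "tensor_sesq \<beta> (x \<otimes>\<^sub>t y) (z \<otimes>\<^sub>t w) = \<beta> x y z w"
    unfolding tensor_sesq_def P_def by auto
qed


section \<open>Quantum graphs\<close>

definition state :: "('b::cstar_algebra \<Rightarrow> complex) \<Rightarrow> bool"
  where "state \<psi> \<longleftrightarrow> clinear \<psi> \<and>
    (\<forall>x. Im (\<psi> (star x * x)) = 0 \<and> Re (\<psi> (star x * x)) \<ge> 0) \<and> \<psi> 1 = 1"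

text \<open>Faithfulness is what makes \<open>\<psi> (star x * y)\<close> an inner product on \<open>B\<close>.\<close>

definition faithful :: "('b::cstar_algebra \<Rightarrow> complex) \<Rightarrow> bool"
  where "faithful \<psi> \<longleftrightarrow> (\<forall>x. \<psi> (star x * x) = 0 \<longrightarrow> x = 0)"

definition L2_inner :: "('b::cstar_algebra \<Rightarrow> complex) \<Rightarrow> 'b \<Rightarrow> 'b \<Rightarrow> complex"
  where "L2_inner \<psi> x y = \<psi> (star x * y)"

text \<open>The inner product of \<open>L\<^sup>2(B \<otimes> B, \<psi> \<otimes> \<psi>)\<close>: on elementary tensors,
  \<open>(\<psi> \<otimes> \<psi>)((x \<otimes> y)\<^sup>* (z \<otimes> w)) = \<psi>(x\<^sup>* z) \<psi>(y\<^sup>* w)\<close>.\<close>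

definition L2_tensor_inner ::
    "('b::cstar_algebra \<Rightarrow> complex) \<Rightarrow> ('b, 'b) tensor \<Rightarrow> ('b, 'b) tensor \<Rightarrow> complex"
  where "L2_tensor_inner \<psi> = tensor_sesq (\<lambda>x y z w. \<psi> (star x * z) * \<psi> (star y * w))"

definition mult_map :: "('b::cstar_algebra, 'b) tensor \<Rightarrow> 'b"
  where "mult_map = tensor_lift (*)"

definition mult_adjoint :: "('b::cstar_algebra \<Rightarrow> complex) \<Rightarrow> 'b \<Rightarrow> ('b, 'b) tensor"
  where "mult_adjoint \<psi> =
    (THE f. \<forall>x t. L2_tensor_inner \<psi> (f x) t = L2_inner \<psi> x (mult_map t))"

definition delta_form :: "real \<Rightarrow> ('b::cstar_algebra \<Rightarrow> complex) \<Rightarrow> bool"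
  where "delta_form \<delta> \<psi> \<longleftrightarrow>
    (\<forall>x. mult_map (mult_adjoint \<psi> x) = complex_of_real (\<delta>\<^sup>2) *\<^sub>C x)"

definition schur_idempotent ::
    "real \<Rightarrow> ('b::cstar_algebra \<Rightarrow> complex) \<Rightarrow> ('b \<Rightarrow> 'b) \<Rightarrow> bool"
  where "schur_idempotent \<delta> \<psi> A \<longleftrightarrow>
    (\<forall>x. mult_map (tensor_map A A (mult_adjoint \<psi> x)) = complex_of_real (\<delta>\<^sup>2) *\<^sub>C A x)"

text \<open>Matrices in \<open>M\<^sub>n(B)\<close> are functions of which only the entries with indices below \<open>n\<close> matter;
  positive means of the form \<open>c\<^sup>* c\<close> in the C*-algebra \<open>M\<^sub>n(B)\<close>.\<close>

definition positive_matrix :: "nat \<Rightarrow> (nat \<Rightarrow> nat \<Rightarrow> 'b::cstar_algebra) \<Rightarrow> bool"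
  where "positive_matrix n a \<longleftrightarrow>
    (\<exists>c. \<forall>i<n. \<forall>j<n. a i j = (\<Sum>k<n. star (c k i) * c k j))"

definition completely_positive :: "('b::cstar_algebra \<Rightarrow> 'b) \<Rightarrow> bool"
  where "completely_positive A \<longleftrightarrow> clinear A \<and>
    (\<forall>n a. positive_matrix n a \<longrightarrow> positive_matrix n (\<lambda>i j. A (a i j)))"

definition finite_quantum_graph ::
    "real \<Rightarrow> ('b::fd_cstar_algebra \<Rightarrow> complex) \<Rightarrow> ('b \<Rightarrow> 'b) \<Rightarrow> bool"
  where "finite_quantum_graph \<delta> \<psi> A \<longleftrightarrow>
    \<delta> > 0 \<and> state \<psi> \<and> faithful \<psi> \<and> delta_form \<delta> \<psi> \<and> clinear A \<and> schur_idempotent \<delta> \<psi> A"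

lemma clinearD:
  assumes "clinear f"
  shows "f (x + y) = f x + f y" "f (c *\<^sub>C x) = c *\<^sub>C f x"
  using assms by (auto simp: clinear_iff)

lemma L2_tensor_inner_tens:
  assumes "clinear \<psi>"
  shows "L2_tensor_inner \<psi> (x \<otimes>\<^sub>t y) (z \<otimes>\<^sub>t w) = L2_inner \<psi> x z * L2_inner \<psi> y w"
  unfolding L2_tensor_inner_def L2_inner_def
  by (subst tensor_sesq(3)) (auto simp: bilin_def clinear_iff antilinear_def algebra_simps
      star_add star_scaleC mult_scaleC_left mult_scaleC_right scaleC_complex_def
      clinearD[OF assms])

lemma mult_map_tens: "mult_map (x \<otimes>\<^sub>t y) = x * y"
  unfolding mult_map_def
  by (subst tensor_lift(2)) (auto simp: bilin_def clinear_iff algebra_simps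
      mult_scaleC_left mult_scaleC_right)

lemma tensor_map_tens:
  assumes "clinear f" "clinear g"
  shows "tensor_map f g (x \<otimes>\<^sub>t y) = f x \<otimes>\<^sub>t g y"
  unfolding tensor_map_def
  by (subst tensor_lift(2)) (auto simp: bilin_def clinear_iff tens_add_left tens_add_right
      tens_scale_left tens_scale_right clinearD[OF assms(1)] clinearD[OF assms(2)])


section \<open>Correspondences\<close>

text \<open>A correspondence enters through its underlying set \<open>X\<close>, its left action and its
  \<open>B\<close>-valued inner product \<open>ip\<close>.\<close>

definition closed_ideal :: "'b::cstar_algebra set \<Rightarrow> bool"
  where "closed_ideal J \<longleftrightarrow> csubspace J \<and> closed J \<and>
    (\<forall>b. \<forall>x\<in>J. b * x \<in> J \<and> x * b \<in> J)"

definition nontrivial_ideal :: "'b::cstar_algebra set \<Rightarrow> bool"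
  where "nontrivial_ideal J \<longleftrightarrow> closed_ideal J \<and> J \<noteq> {0} \<and> J \<noteq> UNIV"

definition full_correspondence :: "('x \<Rightarrow> 'x \<Rightarrow> 'b::cstar_algebra) \<Rightarrow> 'x set \<Rightarrow> bool"
  where "full_correspondence ip X \<longleftrightarrow> closure (cspan {ip x y | x y. x \<in> X \<and> y \<in> X}) = UNIV"

definition minimal_correspondence ::
    "('b::cstar_algebra \<Rightarrow> 'x \<Rightarrow> 'x) \<Rightarrow> ('x \<Rightarrow> 'x \<Rightarrow> 'b) \<Rightarrow> 'x set \<Rightarrow> bool"
  where "minimal_correspondence lact ip X \<longleftrightarrow>
    \<not> (\<exists>J. nontrivial_ideal J \<and>
      cspan {ip x (lact b y) | x b y. x \<in> X \<and> b \<in> J \<and> y \<in> X} \<subseteq> J)"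

definition left_act :: "'b::cstar_algebra \<Rightarrow> ('b, 'b) tensor \<Rightarrow> ('b, 'b) tensor"
  where "left_act a = tensor_map (\<lambda>x. a * x) id"

definition right_act :: "('b::cstar_algebra, 'b) tensor \<Rightarrow> 'b \<Rightarrow> ('b, 'b) tensor"
  where "right_act t b = tensor_map id (\<lambda>y. y * b) t"

text \<open>The inner product of \<open>B \<otimes>\<^sub>\<psi> B\<close>.\<close>

definition corr_inner ::
    "('b::cstar_algebra \<Rightarrow> complex) \<Rightarrow> ('b, 'b) tensor \<Rightarrow> ('b, 'b) tensor \<Rightarrow> 'b"
  where "corr_inner \<psi> = tensor_sesq (\<lambda>x y z w. star y * (\<psi> (star x * z) *\<^sub>C w))"

lemma corr_inner_tens:
  assumes "clinear \<psi>"
  shows "corr_inner \<psi> (x \<otimes>\<^sub>t y) (z \<otimes>\<^sub>t w) = star y * (\<psi> (star x * z) *\<^sub>C w)"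
  unfolding corr_inner_def
  by (subst tensor_sesq(3)) (auto simp: bilin_def clinear_iff antilinear_def algebra_simps
      star_add star_scaleC mult_scaleC_left mult_scaleC_right scaleC_complex_def
      scaleC_add_right scaleC_add_left scaleC_scaleC clinearD[OF assms])

definition edge_vector ::
    "real \<Rightarrow> ('b::cstar_algebra \<Rightarrow> complex) \<Rightarrow> ('b \<Rightarrow> 'b) \<Rightarrow> ('b, 'b) tensor"
  where "edge_vector \<delta> \<psi> A =
    complex_of_real (1 / \<delta>\<^sup>2) *\<^sub>C tensor_map id A (mult_adjoint \<psi> 1)"

definition edge_correspondence ::
    "real \<Rightarrow> ('b::cstar_algebra \<Rightarrow> complex) \<Rightarrow> ('b \<Rightarrow> 'b) \<Rightarrow> ('b, 'b) tensor set"
  where "edge_correspondence \<delta> \<psi> A =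
    cspan {right_act (left_act x (edge_vector \<delta> \<psi> A)) y | x y. True}"

end

theory Submission
  imports Defs
begin

text \<open>
  Everything rests on the inner product formula
  \<open>\<langle>x\<^sub>1 \<cdot> \<epsilon> \<cdot> y\<^sub>1 | x\<^sub>2 \<cdot> \<epsilon> \<cdot> y\<^sub>2\<rangle> = \<delta>\<^sup>-\<^sup>2 y\<^sub>1\<^sup>* A(x\<^sub>1\<^sup>* x\<^sub>2) y\<^sub>2\<close> (lemma \<open>corr_inner_edge_gen\<close>). Since
  \<open>b \<cdot> (x \<cdot> \<epsilon> \<cdot> y) = (b x) \<cdot> \<epsilon> \<cdot> y\<close>, it shows that the vectors \<open>\<langle>X | J X\<rangle>\<close> of the edge
  correspondence \<open>X\<close> are spanned by the elements \<open>y\<^sub>1\<^sup>* A(x\<^sub>1\<^sup>* b x\<^sub>2) y\<^sub>2\<close> with \<open>b \<in> J\<close>. If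
  \<open>A(J) \<subseteq> J\<close>, these all lie in the ideal \<open>J\<close>; conversely, with all four outer elements equal to \<open>1\<close>
  they run through \<open>A(J)\<close>. So an ideal witnesses non-minimality exactly if it is invariant
  under \<open>A\<close> (lemma \<open>corr_invariant_iff\<close>).

  To prove the formula, take a finite set \<open>E\<close> with \<open>z = \<Sum>e\<in>E. \<psi>(e\<^sup>* z) e\<close> for all \<open>z\<close>, as provided by
  the Gram--Schmidt process. It makes \<open>m\<^sup>*\<close> explicit: \<open>m\<^sup>*(x) = \<Sum>e\<in>E. x e \<otimes> e\<^sup>*\<close>. Hence
  \<open>\<epsilon> = \<delta>\<^sup>-\<^sup>2 (\<Sum>e\<in>E. e \<otimes> A(e\<^sup>*))\<close>, and, because a completely positive map preserves adjoints, the
  inner product of \<open>x\<^sub>1 \<cdot> \<epsilon> \<cdot> y\<^sub>1\<close> and \<open>x\<^sub>2 \<cdot> \<epsilon> \<cdot> y\<^sub>2\<close> is \<open>\<delta>\<^sup>-\<^sup>4\<close> times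
  \<open>y\<^sub>1\<^sup>* (\<Sum>e f. A(\<psi>(e\<^sup>* x\<^sub>1\<^sup>* x\<^sub>2 f) e) A(f\<^sup>*)) y\<^sub>2\<close>. The sum over \<open>e\<close> collapses by the reproducing
  property to \<open>\<Sum>f. A(x\<^sub>1\<^sup>* x\<^sub>2 f) A(f\<^sup>*) = m (A \<otimes> A) m\<^sup>*(x\<^sub>1\<^sup>* x\<^sub>2)\<close>, which the Schur idempotent
  identity evaluates to \<open>\<delta>\<^sup>2 A(x\<^sub>1\<^sup>* x\<^sub>2)\<close>.
\<close>

section \<open>Linear maps that preserve adjoints\<close>

lemma clinear_zero: "clinear f \<Longrightarrow> f 0 = 0"
  unfolding clinear_iff by (metis add_cancel_right_left)

lemma clinear_sum: "clinear f \<Longrightarrow> f (sum g S) = (\<Sum>i\<in>S. f (g i))"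
  by (induction S rule: infinite_finite_induct) (simp_all add: clinear_zero clinearD(1))

lemma clinear_diff: "clinear f \<Longrightarrow> f (x - y) = f x - f y"
  using clinearD(1)[of f "x - y" y] by (simp add: eq_diff_eq)

lemma clinear_minus: "clinear f \<Longrightarrow> f (- x) = - f x"
  using clinear_diff[of f 0 x] by (simp add: clinear_zero)

lemma star_zero [simp]: "star (0 :: 'b::cstar_algebra) = 0"
  using star_add[of "0 :: 'b" 0] by simp

lemma star_one [simp]: "star (1 :: 'b::cstar_algebra) = 1"
  using star_mult[of "star (1 :: 'b)" 1] by (simp add: star_star)

lemma star_diff: "star (x - y) = star x - star (y :: 'b::cstar_algebra)"
  using star_add[of "x - y" y] by (simp add: eq_diff_eq)

lemma star_minus: "star (- x) = - star (x :: 'b::cstar_algebra)"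
  using star_diff[of 0 x] by simp

lemma star_sum: "star (sum g S) = (\<Sum>i\<in>S. star (g i :: 'b::cstar_algebra))"
  by (induction S rule: infinite_finite_induct) (simp_all add: star_add)

lemma double_cancel: "a + a = b + b \<Longrightarrow> a = (b :: 'b::real_vector)"
  by (metis scaleR_2 scaleR_cancel_left zero_neq_numeral)

text \<open>Polarization: the values at \<open>(1 + y)\<^sup>* (1 + y)\<close> show that \<open>f(y) + f(y\<^sup>*)\<close> is
  self-adjoint. This for \<open>y\<close> and for \<open>i y\<close> says \<open>f(y)\<^sup>* + f(y\<^sup>*)\<^sup>* = f(y) + f(y\<^sup>*)\<close> and
  \<open>f(y\<^sup>*)\<^sup>* - f(y)\<^sup>* = f(y) - f(y\<^sup>*)\<close>, and the sum of the two equations is \<open>2 f(y\<^sup>*)\<^sup>* = 2 f(y)\<close>.\<close>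

lemma star_preserving_if_selfadjoint_on_squares:
  fixes f :: "'a::cstar_algebra \<Rightarrow> 'b::cstar_algebra"
  assumes f: "clinear f" and sa: "\<And>c. star (f (star c * c)) = f (star c * c)"
  shows "star (f y) = f (star y)"
proof -
  note f_simps = clinearD[OF f]
  have sum_sa: "star (f y) + star (f (star y)) = f y + f (star y)" for y
  proof -
    have "star (1 + y) * (1 + y) = 1 + (y + star y) + star y * y"
      by (simp add: star_add algebra_simps)
    then show ?thesis
      using sa[of "1 + y"] sa[of 1] sa[of y] by (simp add: f_simps star_add)
  qed
  have "\<i> *\<^sub>C (star (f (star y)) - star (f y)) = \<i> *\<^sub>C (f y - f (star y))"
    using sum_sa[of "\<i> *\<^sub>C y"]
    by (simp add: f_simps clinear_minus[OF f] star_minus star_scaleC complex_vector.scale_right_diff_distrib)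
  then have "star (f (star y)) - star (f y) = f y - f (star y)"
    by simp
  then have "(star (f (star y)) - star (f y)) + (star (f y) + star (f (star y)))
      = (f y - f (star y)) + (f y + f (star y))"
    by (simp only: sum_sa)
  then have "star (f (star y)) + star (f (star y)) = f y + f y"
    by simp
  then have "star (f (star y)) = f y"
    by (rule double_cancel)
  then show ?thesis
    by (metis star_star)
qed

lemma completely_positive_star:
  fixes A :: "'b::cstar_algebra \<Rightarrow> 'b"
  assumes "completely_positive A"
  shows "star (A y) = A (star y)"
proof (rule star_preserving_if_selfadjoint_on_squares)
  show "clinear A"
    using assms by (simp add: completely_positive_def)
  fix c :: 'b
  have "positive_matrix 1 (\<lambda>_ _. star c * c)"
    unfolding positive_matrix_def by (rule exI[of _ "\<lambda>_ _. c"]) simp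
  then have "positive_matrix 1 (\<lambda>_ _. A (star c * c))"
    using assms by (simp add: completely_positive_def)
  then obtain d where "A (star c * c) = star d * d"
    by (auto simp: positive_matrix_def)
  then show "star (A (star c * c)) = A (star c * c)"
    by (simp add: star_mult star_star)
qed

lemma state_star:
  assumes "state \<psi>"
  shows "cnj (\<psi> y) = \<psi> (star y)"
  using star_preserving_if_selfadjoint_on_squares[of \<psi> y] assms
  by (simp add: state_def star_complex_def complex_eq_iff)


section \<open>Reproducing families and the adjoint of multiplication\<close>

text \<open>The model is an orthonormal basis of \<open>V\<close> in \<open>L\<^sup>2(B, \<psi>)\<close>, of which the definition keeps the
  expansion of vectors.\<close>

definition reproducing :: "('b::cstar_algebra \<Rightarrow> complex) \<Rightarrow> 'b set \<Rightarrow> 'b set \<Rightarrow> bool"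
  where "reproducing \<psi> V E \<longleftrightarrow> finite E \<and> E \<subseteq> V \<and> (\<forall>z\<in>V. (\<Sum>e\<in>E. \<psi> (star e * z) *\<^sub>C e) = z)"

text \<open>The Gram--Schmidt step. The expansion on \<open>V\<close>, read in the second factor of \<open>\<psi>(u\<^sup>* v)\<close>, already
  implies that the remainder of \<open>v\<close> is orthogonal to \<open>V\<close>.\<close>

lemma reproducing_insert:
  fixes \<psi> :: "'b::cstar_algebra \<Rightarrow> complex"
  assumes \<psi>: "state \<psi>" "faithful \<psi>" and E: "reproducing \<psi> (cspan S) E"
  shows "\<exists>E'. reproducing \<psi> (cspan (insert v S)) E'"
proof -
  have lin: "clinear \<psi>" using \<psi> by (simp add: state_def)
  note \<psi>_simps = clinearD[OF lin] clinear_zero[OF lin] clinear_diff[OF lin] clinear_sum[OF lin]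
  have fin: "finite E" and sub: "E \<subseteq> cspan S"
    and rep: "\<And>z. z \<in> cspan S \<Longrightarrow> (\<Sum>e\<in>E. \<psi> (star e * z) *\<^sub>C e) = z"
    using E by (auto simp: reproducing_def)
  have herm: "cnj (\<psi> (star x * y)) = \<psi> (star y * x)" for x y
    by (simp add: state_star[OF \<psi>(1)] star_mult star_star)
  have mono: "cspan S \<subseteq> cspan (insert v S)"
    by (simp add: complex_vector.span_mono subset_insertI)
  define p where "p = (\<Sum>e\<in>E. \<psi> (star e * v) *\<^sub>C e)"
  define w where "w = v - p"
  have p_in: "p \<in> cspan S"
    unfolding p_def using sub by (intro complex_vector.span_sum complex_vector.span_scale) auto
  have orth: "\<psi> (star w * z) = 0" if z: "z \<in> cspan S" for z
  proof -
    have "\<psi> (star v * z) = \<psi> (star v * (\<Sum>e\<in>E. \<psi> (star e * z) *\<^sub>C e))"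
      by (simp add: rep[OF z])
    also have "\<dots> = (\<Sum>e\<in>E. \<psi> (star e * z) * \<psi> (star v * e))"
      by (simp add: sum_distrib_left mult_scaleC_right \<psi>_simps scaleC_complex_def)
    also have "\<dots> = \<psi> (star p * z)"
      by (simp add: p_def star_sum sum_distrib_right star_scaleC mult_scaleC_left \<psi>_simps
          scaleC_complex_def herm mult.commute)
    finally show ?thesis
      by (simp add: w_def star_diff left_diff_distrib \<psi>_simps)
  qed
  show ?thesis
  proof (cases "w = 0")
    case True
    then have "v \<in> cspan S" using p_in by (simp add: w_def)
    then have "cspan (insert v S) = cspan S"
      by (simp add: complex_vector.span_redundant)
    then show ?thesis using E by auto
  next
    case False
    define N where "N = \<psi> (star w * w)"
    have N: "N = complex_of_real (Re N)" "Re N > 0"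
    proof -
      have "N \<noteq> 0" using False \<psi>(2) by (auto simp: faithful_def N_def)
      moreover have "Im N = 0" "Re N \<ge> 0" using \<psi>(1) by (auto simp: state_def N_def)
      ultimately show "N = complex_of_real (Re N)" "Re N > 0"
        by (auto simp: complex_eq_iff)
    qed
    define r where "r = complex_of_real (1 / sqrt (Re N))"
    have r: "cnj r = r" "r * r * N = 1"
    proof -
      show "cnj r = r" by (simp add: r_def)
      have "r * r * N = complex_of_real (1 / sqrt (Re N) * (1 / sqrt (Re N)) * Re N)"
        unfolding r_def by (subst N(1)) (simp only: of_real_mult)
      also have "\<dots> = 1" using N(2) by (simp add: field_simps)
      finally show "r * r * N = 1" .
    qed
    define e' where "e' = r *\<^sub>C w"
    have w_in: "w \<in> cspan (insert v S)"
      unfolding w_def using p_in mono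
      by (auto intro!: complex_vector.span_diff intro: complex_vector.span_base)
    have orth': "\<psi> (star e' * z) = 0" if "z \<in> cspan S" for z
      using orth[OF that] by (simp add: e'_def star_scaleC mult_scaleC_left \<psi>_simps scaleC_complex_def)
    have "e' \<notin> E"
    proof
      assume "e' \<in> E"
      then have "\<psi> (star e' * e') = 0" using sub orth' by auto
      then have "r * r * N = 0"
        by (simp add: e'_def star_scaleC mult_scaleC_left mult_scaleC_right \<psi>_simps
            scaleC_complex_def N_def r)
      then show False using r by simp
    qed
    define R where "R z = (\<Sum>e\<in>E. \<psi> (star e * z) *\<^sub>C e) + \<psi> (star e' * z) *\<^sub>C e'" for z
    have R_lin: "clinear R"
      by (auto simp: R_def clinear_iff algebra_simps \<psi>_simps scaleC_add_left sum.distrib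
          mult_scaleC_right scaleC_complex_def scaleC_scaleC scaleC_add_right
          complex_vector.scale_sum_right)
    have R_S: "R z = z" if "z \<in> cspan S" for z
      using that by (simp add: R_def rep orth')
    \<comment> \<open>Here the expansion along \<open>E\<close> contributes nothing, and the normalization of \<open>e'\<close> enters.\<close>
    have R_w: "R w = w"
    proof -
      have "\<psi> (star e * w) = 0" if "e \<in> E" for e
        using orth[of e] herm[of w e] that sub by auto
      then show ?thesis
        using r by (simp add: R_def e'_def star_scaleC mult_scaleC_left \<psi>_simps scaleC_complex_def
            scaleC_scaleC flip: N_def)
          (metis mult.assoc mult.commute scaleC_one)
    qed
    have R_v: "R v = v"
    proof -
      have "R (p + w) = p + w"
        by (simp add: clinearD[OF R_lin] R_S[OF p_in] R_w)
      then show ?thesis by (simp add: w_def)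
    qed
    have "R z = z" if "z \<in> cspan (insert v S)" for z
      using that
    proof (induction rule: complex_vector.span_induct_alt)
      case base
      then show ?case by (rule clinear_zero[OF R_lin])
    next
      case (step c x y)
      then have "R x = x"
        using R_v R_S complex_vector.span_base by auto
      then show ?case using step by (simp add: clinearD[OF R_lin])
    qed
    then have "reproducing \<psi> (cspan (insert v S)) (insert e' E)"
      using fin sub mono w_in \<open>e' \<notin> E\<close>
      by (auto simp: reproducing_def R_def e'_def complex_vector.span_scale add.commute)
    then show ?thesis by blast
  qed
qed

lemma reproducing_exists:
  fixes \<psi> :: "'b::fd_cstar_algebra \<Rightarrow> complex"
  assumes "state \<psi>" "faithful \<psi>"
  obtains E where "reproducing \<psi> UNIV E"
proof -
  obtain S where S: "finite S" "\<And>x :: 'b. \<exists>c. x = (\<Sum>s\<in>S. c s *\<^sub>C s)"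
    using finite_dimensional by blast
  have "\<exists>E. reproducing \<psi> (cspan S) E" using S(1)
  proof induction
    case empty
    have "reproducing \<psi> (cspan {}) {}" by (simp add: reproducing_def)
    then show ?case by blast
  next
    case (insert v S)
    then show ?case using reproducing_insert[OF assms] by blast
  qed
  moreover have "cspan S = UNIV"
  proof -
    have "x \<in> cspan S" for x
    proof -
      obtain c where "x = (\<Sum>s\<in>S. c s *\<^sub>C s)" using S(2) by blast
      then show ?thesis
        by (auto intro!: complex_vector.span_sum complex_vector.span_scale
            intro: complex_vector.span_base)
    qed
    then show ?thesis by auto
  qed
  ultimately show ?thesis using that by auto
qed

lemma L2_tensor_inner_linear:
  assumes "clinear \<psi>"
  shows "clinear (L2_tensor_inner \<psi> s)" "antilinear (\<lambda>s. L2_tensor_inner \<psi> s t)"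
  unfolding L2_tensor_inner_def
  by (rule tensor_sesq; auto simp: bilin_def clinear_iff antilinear_def algebra_simps
      star_add star_scaleC mult_scaleC_left mult_scaleC_right scaleC_complex_def
      clinearD[OF assms])+

lemma corr_inner_linear:
  assumes "clinear \<psi>"
  shows "clinear (corr_inner \<psi> s)" "antilinear (\<lambda>s. corr_inner \<psi> s t)"
  unfolding corr_inner_def
  by (rule tensor_sesq; auto simp: bilin_def clinear_iff antilinear_def algebra_simps
      star_add star_scaleC mult_scaleC_left mult_scaleC_right scaleC_complex_def
      scaleC_add_right scaleC_add_left scaleC_scaleC clinearD[OF assms])+

lemma clinear_mult_map: "clinear (mult_map :: ('b::cstar_algebra, 'b) tensor \<Rightarrow> 'b)"
  unfolding mult_map_def by (rule tensor_lift)
    (auto simp: bilin_def clinear_iff algebra_simps mult_scaleC_left mult_scaleC_right)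

lemma antilinear_zero: "antilinear f \<Longrightarrow> f 0 = 0"
  unfolding antilinear_def by (metis add_cancel_right_left)

lemma antilinear_sum: "antilinear f \<Longrightarrow> f (sum g S) = (\<Sum>i\<in>S. f (g i))"
  by (induction S rule: infinite_finite_induct) (auto simp: antilinear_zero, simp add: antilinear_def)

lemma clinear_tens: "clinear (\<lambda>x. x \<otimes>\<^sub>t y)" "clinear (\<lambda>y. x \<otimes>\<^sub>t y)"
  by (simp_all add: clinear_iff tens_add_left tens_add_right tens_scale_left tens_scale_right)

text \<open>Expanding both tensor factors along \<open>E\<close> recovers a tensor from its inner products, so that the
  adjoint of the multiplication map is unique.\<close>

lemma L2_tensor_inner_nondegenerate:
  fixes s :: "('b::fd_cstar_algebra, 'b) tensor"
  assumes \<psi>: "state \<psi>" "faithful \<psi>"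
    and eq: "\<And>t. L2_tensor_inner \<psi> s t = L2_tensor_inner \<psi> s' t"
  shows "s = s'"
proof -
  have lin: "clinear \<psi>" using \<psi> by (simp add: state_def)
  obtain E where E: "reproducing \<psi> UNIV E" using reproducing_exists[OF \<psi>] .
  then have rep: "(\<Sum>e\<in>E. \<psi> (star e * z) *\<^sub>C e) = z" for z by (simp add: reproducing_def)
  define Q where "Q s = (\<Sum>e\<in>E. \<Sum>f\<in>E. cnj (L2_tensor_inner \<psi> s (e \<otimes>\<^sub>t f)) *\<^sub>C (e \<otimes>\<^sub>t f))" for s
  have Q_lin: "clinear Q"
    using L2_tensor_inner_linear(2)[OF lin]
    by (auto simp: Q_def clinear_iff antilinear_def scaleC_add_left sum.distrib scaleC_complex_def
        scaleC_scaleC complex_vector.scale_sum_right)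
  have "Q = id"
  proof (rule clinear_tensor_eqI[OF Q_lin])
    show "clinear id" by (simp add: clinear_iff)
    fix x y :: 'b
    have "Q (x \<otimes>\<^sub>t y) = (\<Sum>e\<in>E. \<Sum>f\<in>E. (\<psi> (star e * x) *\<^sub>C e) \<otimes>\<^sub>t (\<psi> (star f * y) *\<^sub>C f))"
      by (simp add: Q_def L2_tensor_inner_tens[OF lin] L2_inner_def state_star[OF \<psi>(1)] star_mult
          star_star tens_scale_left tens_scale_right scaleC_scaleC mult.commute)
    also have "\<dots> = (\<Sum>e\<in>E. \<psi> (star e * x) *\<^sub>C e) \<otimes>\<^sub>t (\<Sum>f\<in>E. \<psi> (star f * y) *\<^sub>C f)"
      by (simp only: clinear_sum[OF clinear_tens(1)] clinear_sum[OF clinear_tens(2)])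
        (rule sum.swap)
    finally show "Q (x \<otimes>\<^sub>t y) = id (x \<otimes>\<^sub>t y)" by (simp add: rep)
  qed
  then have "s = Q s" "s' = Q s'" by simp_all
  then show ?thesis by (simp add: Q_def eq)
qed

text \<open>The defining relation \<open>\<langle>m\<^sup>*(x) | z \<otimes> w\<rangle> = \<psi>(x\<^sup>* z w)\<close> amounts to expanding \<open>x\<^sup>* z\<close> along \<open>E\<close>.\<close>

lemma mult_adjoint_eq:
  fixes x :: "'b::fd_cstar_algebra"
  assumes \<psi>: "state \<psi>" "faithful \<psi>" and E: "reproducing \<psi> UNIV E"
  shows "mult_adjoint \<psi> x = (\<Sum>e\<in>E. (x * e) \<otimes>\<^sub>t star e)"
proof -
  have lin: "clinear \<psi>" using \<psi> by (simp add: state_def)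
  have rep: "(\<Sum>e\<in>E. \<psi> (star e * z) *\<^sub>C e) = z" for z using E by (simp add: reproducing_def)
  define M where "M x = (\<Sum>e\<in>E. (x * e) \<otimes>\<^sub>t star e)" for x :: 'b
  have M: "L2_tensor_inner \<psi> (M x) t = L2_inner \<psi> x (mult_map t)" for x t
  proof -
    have "L2_tensor_inner \<psi> (M x) = (\<lambda>t. L2_inner \<psi> x (mult_map t))"
    proof (rule clinear_tensor_eqI)
      show "clinear (L2_tensor_inner \<psi> (M x))" by (rule L2_tensor_inner_linear[OF lin])
      show "clinear (\<lambda>t. L2_inner \<psi> x (mult_map t))"
        by (simp add: clinear_iff L2_inner_def clinearD[OF clinear_mult_map] clinearD[OF lin]
            distrib_left mult_scaleC_right)
      fix z w
      have "L2_tensor_inner \<psi> (M x) (z \<otimes>\<^sub>t w)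
          = (\<Sum>e\<in>E. \<psi> (star e * (star x * z)) * \<psi> (e * w))"
        by (simp add: M_def antilinear_sum[OF L2_tensor_inner_linear(2)[OF lin]]
            L2_tensor_inner_tens[OF lin] L2_inner_def star_mult star_star mult.assoc)
      also have "\<dots> = \<psi> ((\<Sum>e\<in>E. \<psi> (star e * (star x * z)) *\<^sub>C e) * w)"
        by (simp add: sum_distrib_right mult_scaleC_left clinear_sum[OF lin] clinearD[OF lin]
            scaleC_complex_def)
      finally show "L2_tensor_inner \<psi> (M x) (z \<otimes>\<^sub>t w) = L2_inner \<psi> x (mult_map (z \<otimes>\<^sub>t w))"
        by (simp add: rep mult_map_tens L2_inner_def mult.assoc)
    qed
    then show ?thesis by simp
  qed
  have "mult_adjoint \<psi> = M"
    unfolding mult_adjoint_def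
  proof (rule the_equality)
    show "\<forall>x t. L2_tensor_inner \<psi> (M x) t = L2_inner \<psi> x (mult_map t)" using M by blast
    fix f
    assume "\<forall>x t. L2_tensor_inner \<psi> (f x) t = L2_inner \<psi> x (mult_map t)"
    then show "f = M"
      using M by (intro ext L2_tensor_inner_nondegenerate[OF \<psi>]) simp
  qed
  then show ?thesis by (simp add: M_def)
qed


section \<open>The edge correspondence\<close>

lemma clinear_tensor_map:
  assumes "clinear f" "clinear g"
  shows "clinear (tensor_map f g)"
  unfolding tensor_map_def
  by (rule tensor_lift) (auto simp: bilin_def clinear_iff tens_add_left tens_add_right
      tens_scale_left tens_scale_right clinearD[OF assms(1)] clinearD[OF assms(2)])

lemma clinear_id: "clinear id" and clinear_mult: "clinear (\<lambda>x. a * x)" "clinear (\<lambda>x. x * a)"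
  for a :: "'b::cstar_algebra"
  by (simp_all add: clinear_iff algebra_simps mult_scaleC_left mult_scaleC_right)

lemma clinear_left_act: "clinear (left_act a)"
  unfolding left_act_def by (intro clinear_tensor_map clinear_id clinear_mult)

lemma clinear_right_act: "clinear (\<lambda>t. right_act t b)"
  unfolding right_act_def by (intro clinear_tensor_map clinear_id clinear_mult)

lemma left_act_tens: "left_act a (x \<otimes>\<^sub>t y) = (a * x) \<otimes>\<^sub>t y"
  by (simp add: left_act_def tensor_map_tens[OF clinear_mult(1) clinear_id])

lemma right_act_tens: "right_act (x \<otimes>\<^sub>t y) b = x \<otimes>\<^sub>t (y * b)"
  by (simp add: right_act_def tensor_map_tens[OF clinear_id clinear_mult(2)])

lemma left_act_edge_gen:
  "left_act b (right_act (left_act x t) y) = right_act (left_act (b * x) t) y"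
proof -
  have "(\<lambda>t. left_act b (right_act (left_act x t) y)) = (\<lambda>t. right_act (left_act (b * x) t) y)"
    by (rule clinear_tensor_eqI)
      (simp_all add: clinear_iff clinearD[OF clinear_left_act] clinearD[OF clinear_right_act]
        left_act_tens right_act_tens mult.assoc)
  then show ?thesis by meson
qed

lemma edge_gen_eq:
  fixes \<psi> :: "'b::fd_cstar_algebra \<Rightarrow> complex"
  assumes "state \<psi>" "faithful \<psi>" "clinear A" "reproducing \<psi> UNIV E"
  shows "right_act (left_act x (edge_vector \<delta> \<psi> A)) y =
    complex_of_real (1 / \<delta>\<^sup>2) *\<^sub>C (\<Sum>e\<in>E. (x * e) \<otimes>\<^sub>t (A (star e) * y))"
  using assms(3)
  by (simp add: edge_vector_def mult_adjoint_eq[OF assms(1,2,4)]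
      clinear_sum[OF clinear_tensor_map[OF clinear_id assms(3)]]
      tensor_map_tens[OF clinear_id] clinearD[OF clinear_left_act] clinearD[OF clinear_right_act]
      clinear_sum[OF clinear_left_act] clinear_sum[OF clinear_right_act]
      left_act_tens right_act_tens del: of_real_divide of_real_power)

text \<open>The adjoint in the first argument of the inner product turns \<open>A (star e)\<close> into \<open>A e\<close>, so that
  one of the two sums over \<open>E\<close> is the expansion of \<open>star x\<^sub>1 * x\<^sub>2 * f\<close>; the other one is
  \<open>m (A \<otimes> A) m\<^sup>*\<close>.\<close>

lemma corr_inner_edge_gen:
  fixes \<psi> :: "'b::fd_cstar_algebra \<Rightarrow> complex"
  assumes G: "finite_quantum_graph \<delta> \<psi> A" and cp: "completely_positive A"
  shows "corr_inner \<psi> (right_act (left_act x1 (edge_vector \<delta> \<psi> A)) y1)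
      (right_act (left_act x2 (edge_vector \<delta> \<psi> A)) y2)
    = complex_of_real (1 / \<delta>\<^sup>2) *\<^sub>C (star y1 * A (star x1 * x2) * y2)"
proof -
  have \<psi>: "state \<psi>" "faithful \<psi>" and A: "clinear A" and schur: "schur_idempotent \<delta> \<psi> A"
    and "\<delta> > 0"
    using G by (auto simp: finite_quantum_graph_def)
  have lin: "clinear \<psi>" using \<psi> by (simp add: state_def)
  obtain E where E: "reproducing \<psi> UNIV E" using reproducing_exists[OF \<psi>] .
  then have rep: "(\<Sum>e\<in>E. \<psi> (star e * z) *\<^sub>C e) = z" for z by (simp add: reproducing_def)
  define k where "k = complex_of_real (1 / \<delta>\<^sup>2)"
  have k: "cnj k = k" by (simp add: k_def)
  define x where "x = star x1 * x2"
  have inner: "(\<Sum>e\<in>E. \<psi> (star e * (x * f)) *\<^sub>C A e) = A (x * f)" for f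
    using arg_cong[OF rep[of "x * f"], of A] by (simp add: clinear_sum[OF A] clinearD[OF A])
  have "corr_inner \<psi> (\<Sum>e\<in>E. (x1 * e) \<otimes>\<^sub>t (A (star e) * y1)) (\<Sum>f\<in>E. (x2 * f) \<otimes>\<^sub>t (A (star f) * y2))
      = (\<Sum>f\<in>E. \<Sum>e\<in>E. star y1 * (\<psi> (star e * (x * f)) *\<^sub>C A e) * (A (star f) * y2))"
    by (simp add: antilinear_sum[OF corr_inner_linear(2)[OF lin]] clinear_sum[OF corr_inner_linear(1)[OF lin]]
        corr_inner_tens[OF lin] star_mult star_star completely_positive_star[OF cp] x_def mult.assoc
        mult_scaleC_left mult_scaleC_right)
  also have "\<dots> = (\<Sum>f\<in>E. star y1 * A (x * f) * (A (star f) * y2))"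
    by (simp only: inner flip: sum_distrib_left sum_distrib_right)
  also have "\<dots> = star y1 * (\<Sum>f\<in>E. A (x * f) * A (star f)) * y2"
    by (simp add: sum_distrib_left sum_distrib_right mult.assoc)
  also have "(\<Sum>f\<in>E. A (x * f) * A (star f)) = mult_map (tensor_map A A (mult_adjoint \<psi> x))"
    by (simp add: mult_adjoint_eq[OF \<psi> E] clinear_sum[OF clinear_tensor_map[OF A A]]
        tensor_map_tens[OF A A] clinear_sum[OF clinear_mult_map] mult_map_tens)
  also have "\<dots> = complex_of_real (\<delta>\<^sup>2) *\<^sub>C A x"
    using schur by (simp add: schur_idempotent_def)
  finally have S: "corr_inner \<psi> (\<Sum>e\<in>E. (x1 * e) \<otimes>\<^sub>t (A (star e) * y1))
      (\<Sum>f\<in>E. (x2 * f) \<otimes>\<^sub>t (A (star f) * y2)) = complex_of_real (\<delta>\<^sup>2) *\<^sub>C (star y1 * A x * y2)"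
    by (simp add: mult_scaleC_left mult_scaleC_right)
  have "k * complex_of_real (\<delta>\<^sup>2) = 1"
    using \<open>\<delta> > 0\<close> by (simp add: k_def)
  then have "k *\<^sub>C k *\<^sub>C complex_of_real (\<delta>\<^sup>2) *\<^sub>C u = k *\<^sub>C u" for u :: 'b
    by (simp add: scaleC_scaleC scaleC_one mult.assoc)
  then show ?thesis
    using corr_inner_linear(2)[OF lin]
    by (simp only: edge_gen_eq[OF \<psi> A E] antilinear_def clinearD[OF corr_inner_linear(1)[OF lin]]
        S k flip: k_def x_def)
qed

text \<open>Both conditions are about the elements \<open>star y\<^sub>1 * A (star x\<^sub>1 * b * x\<^sub>2) * y\<^sub>2\<close>, and sesquilinearity
  of the inner product extends the condition from the generators of the correspondence to all
  of it.\<close>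

lemma corr_invariant_iff:
  fixes \<psi> :: "'b::fd_cstar_algebra \<Rightarrow> complex"
  assumes G: "finite_quantum_graph \<delta> \<psi> A" and cp: "completely_positive A" and J: "closed_ideal J"
  shows "cspan {corr_inner \<psi> s (left_act b t) | s b t.
      s \<in> edge_correspondence \<delta> \<psi> A \<and> b \<in> J \<and> t \<in> edge_correspondence \<delta> \<psi> A} \<subseteq> J
    \<longleftrightarrow> A ` J \<subseteq> J" (is "cspan ?M \<subseteq> J \<longleftrightarrow> _")
proof -
  have "\<delta> > 0" and lin: "clinear \<psi>" using G by (auto simp: finite_quantum_graph_def state_def)
  have sub: "csubspace J" and mult: "\<And>b x. x \<in> J \<Longrightarrow> b * x \<in> J" "\<And>b x. x \<in> J \<Longrightarrow> x * b \<in> J"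
    using J by (auto simp: closed_ideal_def)
  note J_simps = complex_vector.subspace_0[OF sub] complex_vector.subspace_add[OF sub]
    complex_vector.subspace_scale[OF sub]
  define gen where "gen x y = right_act (left_act x (edge_vector \<delta> \<psi> A)) y" for x y
  have E: "edge_correspondence \<delta> \<psi> A = cspan {gen x y | x y. True}"
    by (simp add: edge_correspondence_def gen_def)
  have inner: "corr_inner \<psi> (gen x1 y1) (left_act b (gen x2 y2))
      = complex_of_real (1 / \<delta>\<^sup>2) *\<^sub>C (star y1 * A (star x1 * (b * x2)) * y2)" for x1 y1 b x2 y2
    unfolding gen_def left_act_edge_gen by (rule corr_inner_edge_gen[OF G cp])
  note il = corr_inner_linear[OF lin]
  show ?thesis
  proof
    assume M: "cspan ?M \<subseteq> J"
    show "A ` J \<subseteq> J"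
    proof (intro image_subsetI)
      fix b assume b: "b \<in> J"
      have "gen 1 1 \<in> edge_correspondence \<delta> \<psi> A"
        unfolding E by (rule complex_vector.span_base) blast
      then have "corr_inner \<psi> (gen 1 1) (left_act b (gen 1 1)) \<in> cspan ?M"
        using b by (intro complex_vector.span_base) blast
      then have "complex_of_real (1 / \<delta>\<^sup>2) *\<^sub>C A b \<in> J"
        using M by (auto simp: inner)
      then have "complex_of_real (\<delta>\<^sup>2) *\<^sub>C complex_of_real (1 / \<delta>\<^sup>2) *\<^sub>C A b \<in> J"
        by (rule J_simps)
      then show "A b \<in> J"
        using \<open>\<delta> > 0\<close> by (simp add: scaleC_scaleC scaleC_one)
    qed
  next
    assume AJ: "A ` J \<subseteq> J"
    have "corr_inner \<psi> s (left_act b t) \<in> J"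
      if b: "b \<in> J" and s: "s \<in> cspan {gen x y | x y. True}"
        and t: "t \<in> cspan {gen x y | x y. True}" for s b t
      using s
    proof (induction rule: complex_vector.span_induct_alt)
      case base
      then show ?case by (simp add: antilinear_zero[OF il(2)] J_simps)
    next
      case (step c u s)
      then obtain x1 y1 where u: "u = gen x1 y1" by blast
      have "corr_inner \<psi> u (left_act b t) \<in> J"
        using t
      proof (induction rule: complex_vector.span_induct_alt)
        case base
        then show ?case
          by (simp add: clinear_zero[OF clinear_left_act] clinear_zero[OF il(1)] J_simps)
      next
        case (step d v t)
        then obtain x2 y2 where v: "v = gen x2 y2" by blast
        have "corr_inner \<psi> u (left_act b v) \<in> J"
          using b AJ unfolding u v inner by (intro J_simps mult) (auto intro: mult)
        then show ?case
          using step by (simp add: clinearD[OF clinear_left_act] clinearD[OF il(1)] J_simps)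
      qed
      then show ?case
        using step il(2) by (simp add: antilinear_def J_simps)
    qed
    then show "cspan ?M \<subseteq> J"
      unfolding E by (intro complex_vector.span_minimal[OF _ sub]) blast
  qed
qed

theorem proposition4p9:
  fixes \<delta> :: real and \<psi> :: "'b::fd_cstar_algebra \<Rightarrow> complex" and A :: "'b \<Rightarrow> 'b"
  assumes "finite_quantum_graph \<delta> \<psi> A"
    and "completely_positive A"
    and "full_correspondence (corr_inner \<psi>) (edge_correspondence \<delta> \<psi> A)"
  shows "minimal_correspondence left_act (corr_inner \<psi>) (edge_correspondence \<delta> \<psi> A) \<longleftrightarrow>
    \<not> (\<exists>J :: 'b set. nontrivial_ideal J \<and> A ` J \<subseteq> J)"
  unfolding minimal_correspondence_def
  using corr_invariant_iff[OF assms(1,2)] by (auto simp: nontrivial_ideal_def)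

end
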